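(* Let $k\ge1$ and let $G$ be a $k$-connected partial $k$-path. Then $Z(G)=M(G)=k$.
   Context: All graphs are simple and undirected. A $k$-path is a graph $H$ built together with a sequence $e_0,t_1,e_1,\dots,t_p,e_p$ ($p\ge1$): $t_1$ is a complete graph $K_{k+1}$ and $e_0,e_1$ are distinct $k$-subsets of $t_1$; for $i=2,\dots,p$ a new vertex $u_i$ is added adjacent exactly to the vertices of $e_{i-1}$, $t_i=e_{i-1}\cup\{u_i\}$, and $e_i$ is a $k$-subset of $t_i$ different from $e_{i-1}$. A partial $k$-path is any subgraph of a $k$-path. A graph is $k$-connected if its vertex connectivity is at least $k$ (vertex connectivity of a connected non-complete graph is the minimum number of vertices whose removal disconnects it; that of $K_n$ is $n-1$). For a graph $G$ on $n$ vertices, $S(G)$ is the set of real symmetric $n\times n$ matrices whose off-diagonal entry $(i,j)$ is nonzero iff $ij\in E(G)$ (diagonal unrestricted); $M(G)=\max\{\operatorname{nullity}A:A\in S(G)\}$. $Z(G)$ is the zero forcing number: the minimum size of an initial set of blue vertices from which all vertices become blue under the rule "a blue vertex with exactly one white neighbor turns that neighbor blue". *)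

theory Defs
  imports "Graph_Theory.Kuratowski" "Jordan_Normal_Form.Matrix_Kernel"
begin

text \<open>
  A finite simple undirected graph is a \<^typ>\<open>'a pair_pre_digraph\<close> satisfying \<^locale>\<open>pair_graph\<close>:
  a finite vertex set with a symmetric, irreflexive adjacency relation, so that an edge \<open>ij\<close>
  is the pair of arcs \<open>(i,j)\<close>, \<open>(j,i)\<close>.
\<close>

section \<open>Partial k-paths\<close>

text \<open>
  \<open>k_path_build k H e\<close>: the graph \<open>H\<close> arises from a sequence \<open>e\<^sub>0, t\<^sub>1, e\<^sub>1, \<dots>, t\<^sub>p, e\<^sub>p\<close>
  with \<open>e\<^sub>p = e\<close>.
\<close>

inductive k_path_build :: "nat \<Rightarrow> 'a pair_pre_digraph \<Rightarrow> 'a set \<Rightarrow> bool" for k where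
  init: "\<lbrakk>K\<^bsub>k + 1\<^esub> (with_proj T);
          e\<^sub>0 \<subseteq> pverts T; card e\<^sub>0 = k; e\<^sub>1 \<subseteq> pverts T; card e\<^sub>1 = k; e\<^sub>0 \<noteq> e\<^sub>1\<rbrakk>
         \<Longrightarrow> k_path_build k T e\<^sub>1"
| extend: "\<lbrakk>k_path_build k H e; u \<notin> pverts H; e' \<subseteq> insert u e; card e' = k; e' \<noteq> e\<rbrakk>
         \<Longrightarrow> k_path_build k
               \<lparr>pverts = insert u (pverts H), parcs = parcs H \<union> {u} \<times> e \<union> e \<times> {u}\<rparr> e'"

definition k_path :: "nat \<Rightarrow> 'a pair_pre_digraph \<Rightarrow> bool" where
  "k_path k H \<longleftrightarrow> (\<exists>e. k_path_build k H e)"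

text \<open>
  ``Subgraph of'' is understood up to isomorphism: \<open>f\<close> renames the vertices of \<open>G\<close>. The \<open>k\<close>-path
  lives on \<open>nat\<close> since it may need more vertices than the vertex type of \<open>G\<close> provides.
\<close>

definition partial_k_path :: "nat \<Rightarrow> 'a pair_pre_digraph \<Rightarrow> bool" where
  "partial_k_path k G \<longleftrightarrow>
     (\<exists>(H :: nat pair_pre_digraph) f. k_path k H \<and> inj_on f (pverts G) \<and>
        subgraph (with_proj \<lparr>pverts = f ` pverts G, parcs = map_prod f f ` parcs G\<rparr>)
                 (with_proj H))"

section \<open>Connectivity\<close>

text \<open>
  For a disconnected graph the removed set \<open>X = {}\<close> yields connectivity 0. The library does not
  count the null graph as connected, so \<open>X = pverts G\<close> is also admitted; it never attains the
  minimum, as in a non-complete graph removing all vertices but two non-adjacent ones disconnects.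
\<close>

definition vertex_connectivity :: "'a pair_pre_digraph \<Rightarrow> nat" where
  "vertex_connectivity G =
     (if K\<^bsub>card (pverts G)\<^esub> (with_proj G) then card (pverts G) - 1
      else Min (card ` {X. X \<subseteq> pverts G \<and>
                  \<not> Digraph_Component.connected (with_proj G \<restriction> (pverts G - X))}))"

definition k_connected :: "nat \<Rightarrow> 'a pair_pre_digraph \<Rightarrow> bool" where
  "k_connected k G \<longleftrightarrow> k \<le> vertex_connectivity G"

section \<open>Maximum nullity\<close>

text \<open>
  Rows and columns are indexed by \<open>0, \<dots>, n - 1\<close> through a numbering \<open>f\<close> of the vertices. All
  numberings are admitted; a renumbering conjugates by a permutation matrix, which preserves nullity.
\<close>

definition sym_matrices :: "'a pair_pre_digraph \<Rightarrow> real mat set" where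
  "sym_matrices G =
     {A \<in> carrier_mat (card (pverts G)) (card (pverts G)).
        transpose_mat A = A \<and>
        (\<exists>f. bij_betw f {..<card (pverts G)} (pverts G) \<and>
           (\<forall>i < card (pverts G). \<forall>j < card (pverts G). i \<noteq> j \<longrightarrow>
              (A $$ (i, j) \<noteq> 0 \<longleftrightarrow> (f i, f j) \<in> parcs G)))}"

definition max_nullity :: "'a pair_pre_digraph \<Rightarrow> nat" where
  "max_nullity G = Max (kernel_dim ` sym_matrices G)"

section \<open>Zero forcing\<close>

inductive force_step :: "'a pair_pre_digraph \<Rightarrow> 'a set \<Rightarrow> 'a set \<Rightarrow> bool" for G where
  "\<lbrakk>u \<in> B; {w. (u, w) \<in> parcs G \<and> w \<notin> B} = {v}\<rbrakk> \<Longrightarrow> force_step G B (insert v B)"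

definition zero_forcing_set :: "'a pair_pre_digraph \<Rightarrow> 'a set \<Rightarrow> bool" where
  "zero_forcing_set G B \<longleftrightarrow> B \<subseteq> pverts G \<and> (force_step G)\<^sup>*\<^sup>* B (pverts G)"

definition zero_forcing_number :: "'a pair_pre_digraph \<Rightarrow> nat" where
  "zero_forcing_number G = Min (card ` {B. zero_forcing_set G B})"

end

theory Submission
  imports Defs "Jordan_Normal_Form.DL_Rank"
begin

text \<open>
  A kernel vector of a matrix in \<open>S(G)\<close> that vanishes on a zero forcing set is zero, so
  \<open>M(G) \<le> Z(G)\<close>, and it remains to show \<open>Z(G) \<le> k\<close> and \<open>M(G) \<ge> k\<close>.

  For \<open>Z(G) \<le> k\<close>, order the vertices of \<open>G\<close> as they appear in the \<open>k\<close>-path. The first \<open>k\<close> of them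
  force the rest in this order: if a forcing edge of the \<open>k\<close>-path were missing in \<open>G\<close>, then fewer
  than \<open>k\<close> vertices would separate \<open>G\<close>.

  \<open>M(G) \<ge> k\<close> holds for every \<open>k\<close>-connected graph (Lovasz, Saks, Schrijver): on \<open>n\<close> vertices it has
  vectors in dimension \<open>d = n - k\<close> that are orthogonal exactly for distinct nonadjacent vertices,
  and their Gram matrix has rank at most \<open>d\<close>. To find them, show by induction that
  every induced subgraph \<open>J\<close> has an orthogonal representation in general position. For
  \<open>v \<in> J\<close> let \<open>U v\<close> be the set of representations of \<open>J\<close> that are in general position
  on \<open>J - {v}\<close>. Two elements of \<open>U v\<close> are joined by a polynomial curve, whose generic point inherits
  every linear independence of both. If \<open>v\<close> and \<open>w\<close> are adjacent, then \<open>U v\<close> and \<open>U w\<close>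
  intersect; as \<open>J\<close> is connected once it has more than \<open>d\<close> vertices, all the \<open>U v\<close> intersect
  pairwise, and a generic element of any of them is in general position on \<open>J\<close>.
\<close>

section \<open>Orthogonal projections and polynomial curves\<close>

definition ip :: "nat \<Rightarrow> (nat \<Rightarrow> real) \<Rightarrow> (nat \<Rightarrow> real) \<Rightarrow> real" where
  "ip d x y = (\<Sum>i<d. x i * y i)"

lemma ip_commute: "ip d x y = ip d y x"
  by (simp add: ip_def mult.commute)

lemma ip_scale_left: "ip d (\<lambda>i. c * x i) y = c * ip d x y"
  by (simp add: ip_def sum_distrib_left mult.assoc)

lemma ip_scale_right: "ip d x (\<lambda>i. c * y i) = c * ip d x y"
  by (simp add: ip_def sum_distrib_left mult.left_commute)

lemma ip_diff_left: "ip d (\<lambda>i. x i - y i) z = ip d x z - ip d y z"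
  by (simp add: ip_def sum_subtractf left_diff_distrib)

lemma ip_diff_right: "ip d z (\<lambda>i. x i - y i) = ip d z x - ip d z y"
  by (simp add: ip_def sum_subtractf right_diff_distrib)

lemmas ip_simps = ip_scale_left ip_scale_right ip_diff_left ip_diff_right

lemma ip_self_eq_0_iff: "ip d x x = 0 \<longleftrightarrow> (\<forall>i<d. x i = 0)"
  by (auto simp: ip_def sum_nonneg_eq_0_iff)

text \<open>
  Gram--Schmidt without divisions: \<open>pr d us x\<close> is \<open>sc d us\<close> times the projection of \<open>x\<close> to the
  orthogonal complement of \<open>us\<close>, and \<open>sc d us \<noteq> 0\<close> expresses linear independence of \<open>us\<close>. Both
  are polynomial in the coordinates. Only the first \<open>d\<close> coordinates of a vector matter.
\<close>

fun pr :: "nat \<Rightarrow> (nat \<Rightarrow> real) list \<Rightarrow> (nat \<Rightarrow> real) \<Rightarrow> nat \<Rightarrow> real" where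
  "pr d [] x = x"
| "pr d (u # us) x =
     (\<lambda>i. ip d (pr d us u) (pr d us u) * pr d us x i
        - ip d (pr d us u) (pr d us x) * pr d us u i)"

fun sc :: "nat \<Rightarrow> (nat \<Rightarrow> real) list \<Rightarrow> real" where
  "sc d [] = 1"
| "sc d (u # us) = ip d (pr d us u) (pr d us u) * sc d us"

text \<open>\<open>pr d us x\<close> differs from \<open>sc d us\<close> times \<open>x\<close> only
  by a combination of \<open>us\<close>, which is orthogonal to \<open>y\<close>.\<close>

lemma ip_pr_left:
  assumes "\<And>u. u \<in> set us \<Longrightarrow> ip d u y = 0"
  shows "ip d (pr d us x) y = sc d us * ip d x y"
  using assms
proof (induction us arbitrary: x)
  case (Cons w us)
  have IH: "ip d (pr d us x) y = sc d us * ip d x y" for x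
    using Cons by simp
  have "ip d w y = 0" using Cons.prems by simp
  then show ?case by (simp add: ip_simps IH)
qed simp

lemma pr_eq_scale:
  assumes "\<And>u. u \<in> set us \<Longrightarrow> ip d u x = 0"
  shows "pr d us x = (\<lambda>i. sc d us * x i)"
  using assms
proof (induction us)
  case (Cons w us)
  have IH: "pr d us x = (\<lambda>i. sc d us * x i)"
    using Cons by simp
  have "ip d (pr d us w) x = sc d us * ip d w x"
    using Cons.prems by (intro ip_pr_left) simp
  also have "\<dots> = 0" using Cons.prems by simp
  finally show ?case by (simp add: IH ip_simps mult.assoc)
qed simp

text \<open>Dependence means that some projected vector vanishes; it is a factor in both terms of
  the recursion, and all later steps stay zero.\<close>

lemma pr_eq_0:
  assumes "sc d us = 0" "i < d"
  shows "pr d us x i = 0"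
  using assms
proof (induction us arbitrary: x)
  case (Cons u us)
  show ?case
  proof (cases "sc d us = 0")
    case True
    then have "pr d us z i = 0" for z using Cons by simp
    then show ?thesis by simp
  next
    case False
    then have u0: "ip d (pr d us u) (pr d us u) = 0" using Cons.prems by simp
    then have "pr d us u i = 0" using Cons.prems by (simp add: ip_self_eq_0_iff)
    then show ?thesis using u0 by simp
  qed
qed simp

text \<open>For dependent \<open>us\<close> the projection is zero, so a curve built from
  \<open>pr\<close> stays orthogonal even at degenerate parameters.\<close>

lemma pr_orthogonal:
  assumes "u \<in> set us"
  shows "ip d u (pr d us x) = 0"
proof -
  have "ip d (pr d us x) u = 0" using assms
  proof (induction us arbitrary: x u)
    case (Cons w us)
    let ?z = "pr d (w # us) x"
    have perp: "ip d ?z v = 0" if "v \<in> set us" for v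
      using Cons.IH[OF that] by (simp add: ip_simps)
    have "ip d ?z w = 0"
    proof (cases "sc d us = 0")
      case True
      then have "ip d ?z y = 0" for y
        by (simp add: ip_def pr_eq_0 sum.neutral)
      then show ?thesis .
    next
      case False
      have "sc d us * ip d w ?z = ip d (pr d us w) ?z"
        using perp by (intro ip_pr_left[symmetric]) (simp only: ip_commute)
      also have "\<dots> = 0"
        by (simp add: ip_simps)
      finally show ?thesis using False by (simp only: ip_commute[of d w] mult_eq_0_iff) simp
    qed
    then show ?case using perp Cons.prems by auto
  qed simp
  then show ?thesis by (simp only: ip_commute)
qed

lemma pr_scale: "pr d us (\<lambda>i. c * x i) = (\<lambda>i. c * pr d us x i)"
  by (induction us arbitrary: x) (simp_all add: ip_simps right_diff_distrib mult_ac)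

text \<open>All formulas are homogeneous in each vector. This is needed because \<open>curve\<close>
  meets a given representation only up to scaling.\<close>

lemma pr_map_scale:
  assumes "\<And>v. v \<in> set S \<Longrightarrow> c v \<noteq> 0 \<and> g v = (\<lambda>i. c v * f v i)"
  shows "(\<exists>\<kappa>. \<kappa> \<noteq> 0 \<and> (\<forall>x. pr d (map g S) x = (\<lambda>i. \<kappa> * pr d (map f S) x i)))
    \<and> (sc d (map g S) \<noteq> 0 \<longleftrightarrow> sc d (map f S) \<noteq> 0)"
  using assms
proof (induction S)
  case Nil
  show ?case by (auto intro: exI[of _ 1])
next
  case (Cons v S)
  then obtain \<kappa> where \<kappa>: "\<kappa> \<noteq> 0" "\<And>x. pr d (map g S) x = (\<lambda>i. \<kappa> * pr d (map f S) x i)"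
    and sc: "sc d (map g S) \<noteq> 0 \<longleftrightarrow> sc d (map f S) \<noteq> 0" by auto
  have c: "c v \<noteq> 0" and g: "g v = (\<lambda>i. c v * f v i)" using Cons.prems by auto
  show ?case
  proof
    show "\<exists>\<kappa>. \<kappa> \<noteq> 0 \<and> (\<forall>x. pr d (map g (v # S)) x = (\<lambda>i. \<kappa> * pr d (map f (v # S)) x i))"
      \<comment> \<open>The squared norm contributes \<open>(\<kappa> * c v)^2\<close>, and the
        projection of \<open>x\<close> a further \<open>\<kappa>\<close>.\<close>
      by (rule exI[of _ "\<kappa> * \<kappa> * \<kappa> * c v * c v"])
         (simp add: \<kappa> c g pr_scale ip_simps right_diff_distrib mult_ac)
    show "sc d (map g (v # S)) \<noteq> 0 \<longleftrightarrow> sc d (map f (v # S)) \<noteq> 0"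
      using sc \<kappa>(1) c by (simp add: \<kappa> g pr_scale ip_simps)
  qed
qed

section \<open>Polynomial functions of a real parameter\<close>

definition polyfun :: "(real \<Rightarrow> real) \<Rightarrow> bool" where
  "polyfun h \<longleftrightarrow> (\<exists>p. \<forall>t. h t = poly p t)"

lemma polyfun_const: "polyfun (\<lambda>t. c)"
  unfolding polyfun_def by (rule exI[of _ "[:c:]"]) simp

lemma polyfun_ident: "polyfun (\<lambda>t. t)"
  unfolding polyfun_def by (rule exI[of _ "[:0, 1:]"]) simp

lemma polyfun_add: "polyfun f \<Longrightarrow> polyfun g \<Longrightarrow> polyfun (\<lambda>t. f t + g t)"
  unfolding polyfun_def by (metis poly_add)

lemma polyfun_diff: "polyfun f \<Longrightarrow> polyfun g \<Longrightarrow> polyfun (\<lambda>t. f t - g t)"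
  unfolding polyfun_def by (metis poly_diff)

lemma polyfun_mult: "polyfun f \<Longrightarrow> polyfun g \<Longrightarrow> polyfun (\<lambda>t. f t * g t)"
  unfolding polyfun_def by (metis poly_mult)

lemma polyfun_sum:
  assumes "\<And>i. i \<in> I \<Longrightarrow> polyfun (f i)"
  shows "polyfun (\<lambda>t. \<Sum>i\<in>I. f i t)"
  using assms
  by (induction I rule: infinite_finite_induct) (auto intro: polyfun_const polyfun_add)

lemma polyfun_ip:
  assumes "\<And>i. polyfun (\<lambda>t. x t i)" "\<And>i. polyfun (\<lambda>t. y t i)"
  shows "polyfun (\<lambda>t. ip d (x t) (y t))"
  unfolding ip_def by (intro polyfun_sum polyfun_mult assms)

lemma polyfun_pr:
  assumes "\<And>v i. v \<in> set S \<Longrightarrow> polyfun (\<lambda>t. g t v i)" "\<And>i. polyfun (\<lambda>t. x t i)"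
  shows "polyfun (\<lambda>t. pr d (map (g t) S) (x t) i)"
  using assms
proof (induction S arbitrary: x i)
  case (Cons v S)
  have IH: "polyfun (\<lambda>t. pr d (map (g t) S) (x t) i)" if "\<And>i. polyfun (\<lambda>t. x t i)" for x i
    using Cons that by simp
  show ?case
    by (simp, intro polyfun_diff polyfun_mult polyfun_ip IH Cons.prems) auto
qed simp

lemma polyfun_sc:
  assumes "\<And>v i. v \<in> set S \<Longrightarrow> polyfun (\<lambda>t. g t v i)"
  shows "polyfun (\<lambda>t. sc d (map (g t) S))"
  using assms
  by (induction S) (auto intro!: polyfun_const polyfun_mult polyfun_ip polyfun_pr)

text \<open>A nonzero polynomial has finitely many roots. The form with \<open>eventually\<close>
  lets one \<open>t\<close> meet finitely many conditions.\<close>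

lemma polyfun_eventually_nonzero:
  assumes "polyfun h" "h t \<noteq> 0"
  shows "eventually (\<lambda>t. h t \<noteq> 0) at_top"
proof -
  obtain p where p: "\<And>t. h t = poly p t" using assms(1) by (auto simp: polyfun_def)
  have "finite {t. poly p t = 0}" using assms(2) p by (intro poly_roots_finite) auto
  then obtain B where "\<And>t. poly p t = 0 \<Longrightarrow> t \<le> B"
    using bdd_above_finite unfolding bdd_above_def by blast
  then show ?thesis
    unfolding eventually_at_top_linorder p by (intro exI[of _ "B + 1"]) force
qed

section \<open>Orthogonal representations of graphs\<close>

locale orth_rep =
  fixes d :: nat and E :: "'v rel"
  assumes sym_E: "sym E"
begin

definition orep :: "'v set \<Rightarrow> ('v \<Rightarrow> nat \<Rightarrow> real) \<Rightarrow> bool" where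
  "orep J f \<longleftrightarrow> (\<forall>a\<in>J. \<forall>b\<in>J. a \<noteq> b \<longrightarrow> (a, b) \<notin> E \<longrightarrow> ip d (f a) (f b) = 0)"

definition ind :: "('v \<Rightarrow> nat \<Rightarrow> real) \<Rightarrow> 'v list \<Rightarrow> bool" where
  "ind f S \<longleftrightarrow> sc d (map f S) \<noteq> 0"

definition nonnbrs :: "'v \<Rightarrow> 'v list \<Rightarrow> 'v list" where
  "nonnbrs v vs = filter (\<lambda>u. (u, v) \<notin> E) vs"

text \<open>
  Lists of vertices are ordered backwards: the head is the vertex placed last. A representation
  that is \<open>good\<close> for an ordering can be reached by the sequential projections in \<open>curve\<close>.
\<close>

fun good :: "('v \<Rightarrow> nat \<Rightarrow> real) \<Rightarrow> 'v list \<Rightarrow> bool" where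
  "good f [] = True"
| "good f (v # vs) = (good f vs \<and> ind f (nonnbrs v vs))"

fun curve :: "('v \<Rightarrow> nat \<Rightarrow> real) \<Rightarrow> ('v \<Rightarrow> nat \<Rightarrow> real) \<Rightarrow> 'v list \<Rightarrow> real \<Rightarrow> 'v \<Rightarrow> nat \<Rightarrow> real" where
  "curve f0 f1 [] t = (\<lambda>_ _. 0)"
| "curve f0 f1 (v # vs) t = (curve f0 f1 vs t)
     (v := pr d (map (curve f0 f1 vs t) (nonnbrs v vs)) (\<lambda>i. (1 - t) * f0 v i + t * f1 v i))"

lemma curve_orep: "distinct vs \<Longrightarrow> orep (set vs) (curve f0 f1 vs t)"
proof (induction vs)
  case (Cons v vs)
  let ?g = "curve f0 f1 vs t" and ?h = "curve f0 f1 (v # vs) t"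
  have perp: "ip d (?h u) (?h v) = 0" if "u \<in> set vs" "(u, v) \<notin> E" for u
  proof -
    have "u \<noteq> v" using that Cons.prems by auto
    moreover have "ip d (?g u) (?h v) = 0"
      using that by (simp, intro pr_orthogonal) (auto simp: nonnbrs_def)
    ultimately show ?thesis by simp
  qed
  show ?case
    unfolding orep_def
  proof (intro ballI impI)
    fix a b assume ab: "a \<in> set (v # vs)" "b \<in> set (v # vs)" "a \<noteq> b" "(a, b) \<notin> E"
    consider "a = v" "b \<in> set vs" | "b = v" "a \<in> set vs" | "a \<in> set vs" "b \<in> set vs" "a \<noteq> v" "b \<noteq> v"
      using ab by auto
    then show "ip d (?h a) (?h b) = 0"
    proof cases
      case 1
      then show ?thesis using perp[of b] ab(4) sym_E by (metis ip_commute symD)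
    next
      case 2
      then show ?thesis using perp[of a] ab(4) by metis
    next
      case 3
      then show ?thesis using Cons ab by (simp add: orep_def)
    qed
  qed
qed (simp add: orep_def)

text \<open>Where the interpolated vector is \<open>f v\<close>, it is already orthogonal to the
  nonneighbours placed before \<open>v\<close>, so projecting only rescales it; \<open>good\<close>
  makes the factor nonzero.\<close>

lemma curve_at_end:
  assumes "distinct vs" "orep (set vs) f" "good f vs"
    and "\<And>v. v \<in> set vs \<Longrightarrow> (\<lambda>i. (1 - t) * f0 v i + t * f1 v i) = f v"
  shows "\<forall>v\<in>set vs. \<exists>c. c \<noteq> 0 \<and> curve f0 f1 vs t v = (\<lambda>i. c * f v i)"
  using assms
proof (induction vs)
  case (Cons v vs)
  let ?g = "curve f0 f1 vs t" and ?N = "nonnbrs v vs"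
  have "orep (set vs) f" using Cons.prems by (simp add: orep_def)
  with Cons have IH: "\<forall>u\<in>set vs. \<exists>c. c \<noteq> 0 \<and> ?g u = (\<lambda>i. c * f u i)" by simp
  from bchoice[OF this] obtain c
    where c: "\<And>u. u \<in> set vs \<Longrightarrow> c u \<noteq> 0 \<and> ?g u = (\<lambda>i. c u * f u i)"
    by blast
  have N: "set ?N \<subseteq> set vs" by (auto simp: nonnbrs_def)
  obtain \<kappa> where \<kappa>: "\<kappa> \<noteq> 0" "\<And>x. pr d (map ?g ?N) x = (\<lambda>i. \<kappa> * pr d (map f ?N) x i)"
    using conjunct1[OF pr_map_scale[of ?N c ?g f d]] c N by blast
  have "pr d (map f ?N) (f v) = (\<lambda>i. sc d (map f ?N) * f v i)"
    using Cons.prems by (intro pr_eq_scale) (auto simp: nonnbrs_def orep_def)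
  then have "curve f0 f1 (v # vs) t v = (\<lambda>i. (\<kappa> * sc d (map f ?N)) * f v i)"
    using Cons.prems(4)[of v] by (simp add: \<kappa> mult.assoc)
  moreover have "\<kappa> * sc d (map f ?N) \<noteq> 0" using \<kappa> Cons.prems(3) by (simp add: ind_def)
  ultimately have "\<exists>c. c \<noteq> 0 \<and> curve f0 f1 (v # vs) t v = (\<lambda>i. c * f v i)" by blast
  moreover have "\<exists>c. c \<noteq> 0 \<and> curve f0 f1 (v # vs) t u = (\<lambda>i. c * f u i)" if "u \<in> set vs" for u
  proof -
    have "u \<noteq> v" using that Cons.prems(1) by auto
    then show ?thesis using IH that by simp
  qed
  ultimately show ?case by simp
qed simp

lemma polyfun_curve: "polyfun (\<lambda>t. curve f0 f1 vs t v i)"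
proof (induction vs arbitrary: v i)
  case (Cons w vs)
  show ?case
  proof (cases "v = w")
    case True
    have "polyfun (\<lambda>t. pr d (map (curve f0 f1 vs t) (nonnbrs w vs))
      (\<lambda>i. (1 - t) * f0 w i + t * f1 w i) i)"
      by (intro polyfun_pr Cons polyfun_add polyfun_mult polyfun_diff polyfun_const polyfun_ident)
    then show ?thesis using True by simp
  qed (simp add: Cons)
qed (simp add: polyfun_const)

text \<open>
  The curve is polynomial in \<open>t\<close> and passes, up to nonzero scaling of each vector, through \<open>f0\<close> at
  \<open>t = 0\<close> and \<open>f1\<close> at \<open>t = 1\<close>. A polynomial condition that holds at either point therefore
  holds for all large \<open>t\<close>.
\<close>

lemma orep_join:
  assumes vs: "distinct vs"
    and f0: "orep (set vs) f0" "good f0 vs" and f1: "orep (set vs) f1" "good f1 vs"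
  obtains f where "orep (set vs) f"
    "\<And>S. distinct S \<Longrightarrow> set S \<subseteq> set vs \<Longrightarrow> ind f0 S \<or> ind f1 S \<Longrightarrow> ind f S"
    "\<And>a b. a \<in> set vs \<Longrightarrow> b \<in> set vs \<Longrightarrow> ip d (f0 a) (f0 b) \<noteq> 0 \<or> ip d (f1 a) (f1 b) \<noteq> 0
      \<Longrightarrow> ip d (f a) (f b) \<noteq> 0"
proof -
  let ?g = "curve f0 f1 vs"
  have "\<forall>v\<in>set vs. \<exists>c. c \<noteq> 0 \<and> ?g 0 v = (\<lambda>i. c * f0 v i)"
    by (rule curve_at_end[OF vs f0]) simp
  from bchoice[OF this] obtain c0
    where c0: "\<And>v. v \<in> set vs \<Longrightarrow> c0 v \<noteq> 0 \<and> ?g 0 v = (\<lambda>i. c0 v * f0 v i)"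
    by blast
  have "\<forall>v\<in>set vs. \<exists>c. c \<noteq> 0 \<and> ?g 1 v = (\<lambda>i. c * f1 v i)"
    by (rule curve_at_end[OF vs f1]) simp
  from bchoice[OF this] obtain c1
    where c1: "\<And>v. v \<in> set vs \<Longrightarrow> c1 v \<noteq> 0 \<and> ?g 1 v = (\<lambda>i. c1 v * f1 v i)"
    by blast
  have ind_ev: "eventually (\<lambda>t. ind (?g t) S) at_top"
    if "set S \<subseteq> set vs" "ind f0 S \<or> ind f1 S" for S
  proof -
    have "ind (?g 0) S \<longleftrightarrow> ind f0 S"
      unfolding ind_def by (rule conjunct2[OF pr_map_scale[of S c0]]) (use c0 that(1) in blast)
    moreover have "ind (?g 1) S \<longleftrightarrow> ind f1 S"
      unfolding ind_def by (rule conjunct2[OF pr_map_scale[of S c1]]) (use c1 that(1) in blast)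
    ultimately have "ind (?g 0) S \<or> ind (?g 1) S" using that(2) by blast
    then obtain t where "ind (?g t) S" by blast
    then show ?thesis
      unfolding ind_def by (intro polyfun_eventually_nonzero[of _ t] polyfun_sc polyfun_curve)
  qed
  have ip_ev: "eventually (\<lambda>t. ip d (?g t a) (?g t b) \<noteq> 0) at_top"
    if "a \<in> set vs" "b \<in> set vs" "ip d (f0 a) (f0 b) \<noteq> 0 \<or> ip d (f1 a) (f1 b) \<noteq> 0" for a b
  proof -
    have "ip d (f0 a) (f0 b) \<noteq> 0 \<Longrightarrow> ip d (?g 0 a) (?g 0 b) \<noteq> 0"
      "ip d (f1 a) (f1 b) \<noteq> 0 \<Longrightarrow> ip d (?g 1 a) (?g 1 b) \<noteq> 0"
      using c0 c1 that(1,2) by (simp_all add: ip_simps)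
    with that(3) obtain t where "ip d (?g t a) (?g t b) \<noteq> 0" by blast
    then show ?thesis
      by (intro polyfun_eventually_nonzero[of _ t] polyfun_ip polyfun_curve)
  qed
  let ?\<S> = "{S. set S \<subseteq> set vs \<and> distinct S \<and> (ind f0 S \<or> ind f1 S)}"
  let ?\<P> = "{(a, b). a \<in> set vs \<and> b \<in> set vs
    \<and> (ip d (f0 a) (f0 b) \<noteq> 0 \<or> ip d (f1 a) (f1 b) \<noteq> 0)}"
  have "finite ?\<S>"
    by (rule finite_subset[OF _ finite_subset_distinct[of "set vs"]]) auto
  then have 1: "eventually (\<lambda>t. \<forall>S\<in>?\<S>. ind (?g t) S) at_top"
    by (intro eventually_ball_finite) (auto intro: ind_ev)
  have "finite ?\<P>"
    by (rule finite_subset[of _ "set vs \<times> set vs"]) auto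
  then have 2: "eventually (\<lambda>t. \<forall>(a, b)\<in>?\<P>. ip d (?g t a) (?g t b) \<noteq> 0) at_top"
    by (intro eventually_ball_finite) (auto intro: ip_ev)
  obtain t where t: "\<forall>S\<in>?\<S>. ind (?g t) S" "\<forall>(a, b)\<in>?\<P>. ip d (?g t a) (?g t b) \<noteq> 0"
    using eventually_happens[OF eventually_conj[OF 1 2]] by auto
  show ?thesis
    by (rule that[of "?g t"]) (use t curve_orep[OF vs] in auto)
qed

section \<open>Representations in general position\<close>

lemma ind_cong: "(\<And>v. v \<in> set S \<Longrightarrow> f v = g v) \<Longrightarrow> ind f S = ind g S"
  unfolding ind_def by (simp cong: map_cong)

definition gen_pos :: "'v set \<Rightarrow> ('v \<Rightarrow> nat \<Rightarrow> real) \<Rightarrow> bool" where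
  "gen_pos J f \<longleftrightarrow> orep J f \<and> (\<forall>S. distinct S \<longrightarrow> set S \<subseteq> J \<longrightarrow> length S \<le> d \<longrightarrow> ind f S)"

lemma gen_pos_mono: "gen_pos J f \<Longrightarrow> K \<subseteq> J \<Longrightarrow> gen_pos K f"
  unfolding gen_pos_def orep_def by blast

lemma gen_pos_cong:
  assumes "gen_pos J f" "\<And>v. v \<in> J \<Longrightarrow> f v = g v"
  shows "gen_pos J g"
proof -
  have "ind g S" if "distinct S" "set S \<subseteq> J" "length S \<le> d" for S
    using assms that ind_cong[of S f g] unfolding gen_pos_def by blast
  then show ?thesis using assms unfolding gen_pos_def orep_def by simp
qed

lemma gen_pos_transfer:
  assumes "gen_pos K g" "K \<subseteq> J" "orep J h"
    and "\<And>S. distinct S \<Longrightarrow> set S \<subseteq> J \<Longrightarrow> ind g S \<Longrightarrow> ind h S"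
  shows "gen_pos K h"
  unfolding gen_pos_def
proof (intro conjI allI impI)
  show "orep K h" using assms(2,3) unfolding orep_def by blast
  show "ind h S" if "distinct S" "set S \<subseteq> K" "length S \<le> d" for S
    using that assms(1,2) by (intro assms(4)) (auto simp: gen_pos_def)
qed

lemma orep_insert_zero:
  assumes "orep (J - {v}) f"
  shows "orep J (f(v := \<lambda>_. 0))"
proof -
  have "ip d (\<lambda>_. 0) y = 0" "ip d y (\<lambda>_. 0) = 0" for y by (simp_all add: ip_def)
  then show ?thesis using assms unfolding orep_def by auto
qed

text \<open>Distinct standard basis vectors are orthogonal and independent, whatever the edges
  are.\<close>

lemma gen_pos_small:
  assumes "finite J" "card J \<le> d"
  shows "\<exists>f. gen_pos J f"
proof -
  obtain \<beta> where \<beta>: "inj_on \<beta> J" "\<beta> ` J \<subseteq> {..<d}"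
    using assms card_le_inj[of J "{..<d}"] by auto
  define f where "f v = (\<lambda>i. if i = \<beta> v then 1 else (0::real))" for v
  have ip_f: "ip d (f u) (f v) = (if u = v then 1 else 0)" if "u \<in> J" "v \<in> J" for u v
  proof -
    have "ip d (f u) (f v) = (\<Sum>i<d. if i = \<beta> u then (if \<beta> u = \<beta> v then 1 else 0) else 0)"
      unfolding ip_def f_def by (intro sum.cong) auto
    also have "\<dots> = (if \<beta> u = \<beta> v then 1 else 0)"
      using that \<beta>(2) by (subst sum.delta) auto
    finally show ?thesis using that \<beta>(1) by (auto simp: inj_on_def)
  qed
  have "sc d (map f S) \<noteq> 0" if "distinct S" "set S \<subseteq> J" for S
    using that
  proof (induction S)
    case (Cons v S)
    have "pr d (map f S) (f v) = (\<lambda>i. sc d (map f S) * f v i)"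
      using Cons.prems by (intro pr_eq_scale) (auto simp: ip_f subset_iff)
    then show ?case using Cons by (simp add: ip_simps ip_f)
  qed simp
  then have "gen_pos J f" unfolding gen_pos_def ind_def orep_def by (simp add: ip_f)
  then show ?thesis by blast
qed

end

text \<open>For \<open>d = card V - k\<close>, a set of more than \<open>d\<close> vertices is what
  remains after deleting fewer than \<open>k\<close>, so \<open>conn\<close> expresses
  \<open>k\<close>-connectivity.\<close>

locale connected_orth_rep = orth_rep d E for d and E :: "'v rel" +
  fixes V :: "'v set"
  assumes finite_V: "finite V"
    and irrefl_E: "(v, v) \<notin> E"
    and d_pos: "0 < d"
    and conn: "\<lbrakk>J \<subseteq> V; d < card J; u \<in> J; v \<in> J\<rbrakk> \<Longrightarrow> (u, v) \<in> (E \<inter> J \<times> J)\<^sup>*"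
begin

text \<open>Otherwise \<open>v\<close> and its nonneighbours would be more than \<open>d\<close>
  vertices inducing a graph in which \<open>v\<close> is isolated.\<close>

lemma card_nonnbrs:
  assumes "v \<in> V"
  shows "card {u \<in> V. u \<noteq> v \<and> (u, v) \<notin> E} < d"
proof (rule ccontr)
  let ?N = "{u \<in> V. u \<noteq> v \<and> (u, v) \<notin> E}" and ?J = "insert v {u \<in> V. u \<noteq> v \<and> (u, v) \<notin> E}"
  assume "\<not> card ?N < d"
  moreover have "finite ?N" using finite_V by simp
  ultimately have big: "d < card ?J" by simp
  have "?N \<noteq> {}"
  proof
    assume "?N = {}"
    then have "card ?N = 0" by (simp only: card.empty)
    then show False using \<open>\<not> card ?N < d\<close> d_pos by linarith
  qed
  then obtain u where u: "u \<in> ?N" by blast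
  have "?J \<subseteq> V" using assms by auto
  then have "(u, v) \<in> (E \<inter> ?J \<times> ?J)\<^sup>*" using conn[of ?J u v] big u by blast
  then show False
  proof (cases rule: rtranclE)
    case base
    then show False using u by simp
  next
    case (step y)
    then show False using irrefl_E by auto
  qed
qed

lemma length_nonnbrs:
  assumes "distinct (v # vs)" "set (v # vs) \<subseteq> V"
  shows "length (nonnbrs v vs) < d"
proof -
  have "length (nonnbrs v vs) = card (set (nonnbrs v vs))"
    using assms by (intro distinct_card[symmetric]) (simp add: nonnbrs_def)
  also have "\<dots> \<le> card {u \<in> V. u \<noteq> v \<and> (u, v) \<notin> E}"
    using assms finite_V by (intro card_mono) (auto simp: nonnbrs_def)
  also have "\<dots> < d" using assms by (intro card_nonnbrs) simp
  finally show ?thesis .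
qed

lemma gen_pos_ind_nonnbrs:
  assumes "distinct (v # vs)" "set (v # vs) \<subseteq> V" "gen_pos (set vs) f"
  shows "ind f (nonnbrs v vs)"
proof -
  have "distinct (nonnbrs v vs)" "set (nonnbrs v vs) \<subseteq> set vs" "length (nonnbrs v vs) \<le> d"
    using assms(1) length_nonnbrs[OF assms(1,2)] by (auto simp: nonnbrs_def)
  then show ?thesis using assms(3) unfolding gen_pos_def by blast
qed

text \<open>\<open>good\<close> tests only lists of nonneighbours, which have fewer than
  \<open>d\<close> entries, so general position covers them in any ordering.\<close>

lemma gen_pos_good:
  assumes "distinct vs" "set vs \<subseteq> V" "gen_pos (set vs) f"
  shows "good f vs"
  using assms
proof (induction vs)
  case (Cons v vs)
  have "gen_pos (set vs) f" using Cons.prems by (auto intro: gen_pos_mono)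
  then show ?case using Cons gen_pos_ind_nonnbrs[of v vs f] by simp
qed simp

text \<open>The set \<open>U v\<close> of the proof idea. The vector at \<open>v\<close> may be
  zero, which is how first elements are obtained.\<close>

definition near_gen_pos :: "'v \<Rightarrow> 'v set \<Rightarrow> ('v \<Rightarrow> nat \<Rightarrow> real) \<Rightarrow> bool" where
  "near_gen_pos v J f \<longleftrightarrow> orep J f \<and> gen_pos (J - {v}) f"

lemma near_gen_pos_transfer:
  assumes "near_gen_pos v J g" "near_gen_pos w J h"
    and "\<And>S. distinct S \<Longrightarrow> set S \<subseteq> J \<Longrightarrow> ind g S \<Longrightarrow> ind h S"
  shows "near_gen_pos v J h"
proof -
  have "gen_pos (J - {v}) h"
    by (rule gen_pos_transfer[of _ g J])
      (use assms(1,2) in \<open>auto simp: near_gen_pos_def intro: assms(3)\<close>)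
  then show ?thesis using assms(2) by (simp add: near_gen_pos_def)
qed

lemma near_gen_pos_join:
  assumes J: "J \<subseteq> V" "v \<in> J" and f: "near_gen_pos v J f" and g: "near_gen_pos v J g"
  obtains h where "near_gen_pos v J h"
    "\<And>S. distinct S \<Longrightarrow> set S \<subseteq> J \<Longrightarrow> ind f S \<or> ind g S \<Longrightarrow> ind h S"
    "\<And>a b. a \<in> J \<Longrightarrow> b \<in> J \<Longrightarrow> ip d (f a) (f b) \<noteq> 0 \<or> ip d (g a) (g b) \<noteq> 0
      \<Longrightarrow> ip d (h a) (h b) \<noteq> 0"
proof -
  have "finite (J - {v})" using J finite_V by (auto intro: finite_subset)
  then obtain vs where vs: "set vs = J - {v}" "distinct vs" using finite_distinct_list by blast
  \<comment> \<open>With \<open>v\<close> placed last, \<open>good\<close> never tests a list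
    containing \<open>v\<close>.\<close>
  have J_eq: "set (v # vs) = J" and dist: "distinct (v # vs)" using vs J by auto
  have "good F (v # vs)" if "near_gen_pos v J F" for F
    using that gen_pos_good[of vs F] gen_pos_ind_nonnbrs[of v vs F] vs J dist J_eq
    unfolding near_gen_pos_def by auto
  then obtain h where h: "orep J h"
    "\<And>S. distinct S \<Longrightarrow> set S \<subseteq> J \<Longrightarrow> ind f S \<or> ind g S \<Longrightarrow> ind h S"
    "\<And>a b. a \<in> J \<Longrightarrow> b \<in> J \<Longrightarrow> ip d (f a) (f b) \<noteq> 0 \<or> ip d (g a) (g b) \<noteq> 0
      \<Longrightarrow> ip d (h a) (h b) \<noteq> 0"
    using orep_join[OF dist, of f g, unfolded J_eq] f g unfolding near_gen_pos_def by metis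
  moreover have "gen_pos (J - {v}) h"
    by (rule gen_pos_transfer[of _ f, OF _ _ h(1)]) (use f h(2) in \<open>auto simp: near_gen_pos_def\<close>)
  then have "near_gen_pos v J h" using h(1) by (simp add: near_gen_pos_def)
  ultimately show ?thesis using that by blast
qed

text \<open>
  Since \<open>v\<close> and \<open>w\<close> are adjacent, neither restricts the choice of the other's vector, so both
  representations are good for an ordering that ends in \<open>v, w\<close>.
\<close>

lemma near_gen_pos_adjacent:
  assumes J: "J \<subseteq> V" "v \<in> J" "w \<in> J" and vw: "(v, w) \<in> E"
    and f: "gen_pos (J - {w}) f" and g: "gen_pos (J - {v}) g"
  obtains h where "near_gen_pos v J h" "near_gen_pos w J h"
proof -
  have neq: "v \<noteq> w" using vw irrefl_E by auto
  have "finite (J - {v, w})" using J finite_V by (auto intro: finite_subset)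
  from finite_distinct_list[OF this] obtain vs where vs: "set vs = J - {v, w}" "distinct vs"
    by (elim exE conjE)
  let ?l = "w # v # vs"
  have "set ?l = insert w (insert v (J - {v, w}))" by (simp only: list.set vs(1))
  also have "\<dots> = J" using J(2,3) by blast
  finally have J_eq: "set ?l = J" .
  have dist: "distinct ?l" using vs neq by simp
  \<comment> \<open>The zero vector fills in the missing vertex without harming orthogonality;
    \<open>good\<close> tests no list containing \<open>v\<close> or \<open>w\<close> in this
    ordering.\<close>
  define f' where "f' = f(w := \<lambda>_. 0)"
  define g' where "g' = g(v := \<lambda>_. 0)"
  have "orep (J - {w}) f" "orep (J - {v}) g" using f g by (simp_all add: gen_pos_def)
  from this[THEN orep_insert_zero] have orep': "orep J f'" "orep J g'"
    by (simp_all only: f'_def g'_def)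
  have f': "gen_pos (J - {w}) f'" by (rule gen_pos_cong[OF f]) (simp add: f'_def)
  have g': "gen_pos (J - {v}) g'" by (rule gen_pos_cong[OF g]) (simp add: g'_def)
  have good: "good F ?l" if "gen_pos (J - {v, w}) F" for F
  proof -
    have F: "gen_pos (set vs) F" using that vs by simp
    have "nonnbrs w (v # vs) = nonnbrs w vs" using vw by (simp add: nonnbrs_def)
    moreover have "distinct (v # vs)" "set (v # vs) \<subseteq> V" "distinct (w # vs)" "set (w # vs) \<subseteq> V"
      using dist J J_eq by auto
    then have "ind F (nonnbrs v vs)" "ind F (nonnbrs w vs)" "good F vs"
      using F by (simp_all add: gen_pos_ind_nonnbrs gen_pos_good)
    ultimately show ?thesis by simp
  qed
  have "gen_pos (J - {v, w}) f'" "gen_pos (J - {v, w}) g'"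
    using gen_pos_mono[OF f', of "J - {v, w}"] gen_pos_mono[OF g', of "J - {v, w}"] by auto
  from this[THEN good] obtain h where h: "orep J h"
    "\<And>S. distinct S \<Longrightarrow> set S \<subseteq> J \<Longrightarrow> ind f' S \<or> ind g' S \<Longrightarrow> ind h S"
    using orep_join[OF dist, of f' g', unfolded J_eq] orep' by metis
  have "gen_pos (J - {v}) h" by (rule gen_pos_transfer[OF g' _ h(1)]) (use h(2) in auto)
  moreover have "gen_pos (J - {w}) h" by (rule gen_pos_transfer[OF f' _ h(1)]) (use h(2) in auto)
  ultimately have "near_gen_pos v J h" "near_gen_pos w J h"
    using h(1) by (simp_all add: near_gen_pos_def)
  then show ?thesis using that by blast
qed

lemma gen_pos_exists:
  assumes "J \<subseteq> V"
  shows "\<exists>f. gen_pos J f"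
  using assms
proof (induction "card J" arbitrary: J rule: less_induct)
  case less
  have fin: "finite J" using less.prems finite_V finite_subset by blast
  show ?case
  proof (cases "card J \<le> d")
    case True
    then show ?thesis using gen_pos_small fin by blast
  next
    case False
    have gp: "\<exists>f. gen_pos (J - {v}) f" if v: "v \<in> J" for v
      using less.hyps[of "J - {v}"] less.prems v fin by (meson Diff_subset card_Diff1_less subset_trans)
    have ne: "\<exists>f. near_gen_pos v J f" if v: "v \<in> J" for v
    proof -
      obtain f where f: "gen_pos (J - {v}) f" using gp[OF v] by blast
      have "gen_pos (J - {v}) (f(v := \<lambda>_. 0))" by (rule gen_pos_cong[OF f]) simp
      moreover have "orep J (f(v := \<lambda>_. 0))" using f by (auto simp: gen_pos_def intro: orep_insert_zero)
      ultimately show ?thesis unfolding near_gen_pos_def by blast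
    qed
    have meet: "\<exists>h. near_gen_pos v J h \<and> near_gen_pos w J h" if "v \<in> J" "w \<in> J" for v w
    proof -
      have "(v, w) \<in> (E \<inter> J \<times> J)\<^sup>*" using conn[of J v w] less.prems False that by simp
      then show ?thesis
      proof (induction rule: rtrancl_induct)
        case base
        then show ?case using ne[OF that(1)] by blast
      next
        case (step x y)
        then obtain h where h: "near_gen_pos v J h" "near_gen_pos x J h" by blast
        have xy: "x \<in> J" "y \<in> J" "(x, y) \<in> E" using step by auto
        obtain f g where "gen_pos (J - {y}) f" "gen_pos (J - {x}) g" using gp xy by blast
        then obtain h' where h': "near_gen_pos x J h'" "near_gen_pos y J h'"
          using near_gen_pos_adjacent less.prems xy by metis
        \<comment> \<open>Joining \<open>h\<close> and \<open>h'\<close> inside \<open>U x\<close>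
          gives an element of \<open>U v\<close>, \<open>U x\<close> and \<open>U y\<close> at
          once.\<close>
        obtain h'' where h'': "near_gen_pos x J h''"
          "\<And>S. distinct S \<Longrightarrow> set S \<subseteq> J \<Longrightarrow> ind h S \<or> ind h' S \<Longrightarrow> ind h'' S"
          using near_gen_pos_join[OF less.prems xy(1) h(2) h'(1)] by metis
        have "near_gen_pos v J h''"
          by (rule near_gen_pos_transfer[OF h(1) h''(1)]) (use h''(2) in auto)
        moreover have "near_gen_pos y J h''"
          by (rule near_gen_pos_transfer[OF h'(2) h''(1)]) (use h''(2) in auto)
        ultimately show ?case by blast
      qed
    qed
    \<comment> \<open>A list \<open>S\<close> of length at most \<open>d\<close> misses some \<open>w \<in> J\<close>, so it is independent in
      a representation that is near general position both at \<open>v\<close> and at \<open>w\<close>.\<close>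
    have "J \<noteq> {}" using False by auto
    then obtain v where v: "v \<in> J" by blast
    have "\<exists>h. near_gen_pos v J h \<and> (\<forall>S\<in>\<S>. ind h S)"
      if "finite \<S>" "\<S> \<subseteq> {S. set S \<subseteq> J \<and> distinct S \<and> length S \<le> d}" for \<S>
      using that
    proof (induction \<S> rule: finite_induct)
      case empty
      then show ?case using ne[OF v] by blast
    next
      case (insert S \<S>)
      then obtain h where h: "near_gen_pos v J h" "\<forall>S\<in>\<S>. ind h S" by blast
      have S: "set S \<subseteq> J" "distinct S" "length S \<le> d" using insert.prems by auto
      have "card (set S) < card J" using S False by (simp add: distinct_card)
      then obtain w where w: "w \<in> J" "w \<notin> set S" using S by (metis less_irrefl subsetI subset_antisym)
      obtain h' where h': "near_gen_pos v J h'" "near_gen_pos w J h'" using meet[OF v w(1)] by blast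
      have "ind h' S" using h'(2) S w unfolding near_gen_pos_def gen_pos_def by blast
      moreover obtain h'' where "near_gen_pos v J h''"
          "\<And>S. distinct S \<Longrightarrow> set S \<subseteq> J \<Longrightarrow> ind h S \<or> ind h' S \<Longrightarrow> ind h'' S"
        using near_gen_pos_join[OF less.prems v h(1) h'(1)] by metis
      ultimately show ?case using S h insert.prems by blast
    qed
    moreover have "finite {S. set S \<subseteq> J \<and> distinct S \<and> length S \<le> d}"
      by (rule finite_subset[OF _ finite_subset_distinct[OF fin]]) auto
    ultimately obtain h where h: "near_gen_pos v J h"
      "\<forall>S\<in>{S. set S \<subseteq> J \<and> distinct S \<and> length S \<le> d}. ind h S" by (meson subset_refl)
    have "orep J h" using h(1) by (simp add: near_gen_pos_def)
    then have "gen_pos J h" using h(2) by (simp add: gen_pos_def)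
    then show ?thesis by blast
  qed
qed

text \<open>General position leaves open whether adjacent vertices get nonorthogonal vectors. This
  is arranged one edge at a time, each join preserving the edges already treated.\<close>

theorem faithful_orth_rep:
  obtains f where "\<And>a b. a \<in> V \<Longrightarrow> b \<in> V \<Longrightarrow> a \<noteq> b \<Longrightarrow> ip d (f a) (f b) \<noteq> 0 \<longleftrightarrow> (a, b) \<in> E"
proof -
  have "\<exists>f. gen_pos V f \<and> (\<forall>(a, b)\<in>F. ip d (f a) (f b) \<noteq> 0)"
    if "finite F" "F \<subseteq> E \<inter> V \<times> V" for F
    using that
  proof (induction F rule: finite_induct)
    case empty
    then show ?case using gen_pos_exists[of V] by auto
  next
    case (insert e F)
    obtain a b where e: "e = (a, b)" by force
    have ab: "a \<in> V" "b \<in> V" "(a, b) \<in> E" "a \<noteq> b" using insert.prems e irrefl_E by auto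
    obtain f where f: "gen_pos V f" "\<forall>(a, b)\<in>F. ip d (f a) (f b) \<noteq> 0" using insert by blast
    obtain vs where vs: "set vs = V - {b}" "distinct vs"
      using finite_distinct_list finite_V by (metis finite_Diff)
    \<comment> \<open>The strict bound leaves room for \<open>a\<close>: the list
      \<open>a # ?N\<close> still has at most \<open>d\<close> entries, hence is
      independent.\<close>
    have len: "length (nonnbrs b vs) < d" using vs ab by (intro length_nonnbrs) auto
    let ?N = "nonnbrs b vs"
    \<comment> \<open>The part of \<open>f a\<close> orthogonal to the nonneighbours of
      \<open>b\<close> is an admissible vector for \<open>b\<close> that is not orthogonal to
      \<open>f a\<close>.\<close>
    define x where "x = pr d (map f ?N) (f a)"
    have N: "set ?N \<subseteq> V - {b}" "distinct ?N" "a \<notin> set ?N" using vs ab by (auto simp: nonnbrs_def)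
    have "distinct (a # ?N)" "set (a # ?N) \<subseteq> V" "length (a # ?N) \<le> d" using N ab len by auto
    then have "ind f (a # ?N)" using f(1) unfolding gen_pos_def by blast
    then have xx: "ip d x x \<noteq> 0" by (simp add: ind_def x_def)
    have perp: "ip d (f u) x = 0" if "u \<in> set ?N" for u
      using that unfolding x_def by (intro pr_orthogonal) simp
    have "ip d x x = sc d (map f ?N) * ip d (f a) x"
      unfolding x_def by (intro ip_pr_left) (use perp[unfolded x_def] in auto)
    then have ax: "ip d (f a) x \<noteq> 0" using xx by auto
    define g where "g = f(b := x)"
    have "ip d (g c) (g b) = 0" "ip d (g b) (g c) = 0" if "c \<in> V" "c \<noteq> b" "(c, b) \<notin> E" for c
      using perp[of c] that vs by (auto simp: g_def nonnbrs_def ip_commute[of d x])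
    moreover have "orep (V - {b}) g" using f(1) unfolding g_def gen_pos_def orep_def by auto
    ultimately have "orep V g" using sym_E unfolding orep_def
      by (metis DiffI empty_iff insert_iff symD)
    moreover have "gen_pos (V - {b}) g"
      by (rule gen_pos_cong[OF gen_pos_mono[OF f(1)]]) (auto simp: g_def)
    ultimately have g: "near_gen_pos b V g" by (simp add: near_gen_pos_def)
    \<comment> \<open>\<open>g\<close> may fail general position on lists containing
      \<open>b\<close>; joining it with \<open>f\<close> repairs this and keeps the new nonzero
      product.\<close>
    have "near_gen_pos b V f"
      using f(1) gen_pos_mono[OF f(1)] by (auto simp: near_gen_pos_def gen_pos_def)
    from near_gen_pos_join[OF subset_refl ab(2) this g] obtain h where h: "near_gen_pos b V h"
      "\<And>S. distinct S \<Longrightarrow> set S \<subseteq> V \<Longrightarrow> ind f S \<or> ind g S \<Longrightarrow> ind h S"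
      "\<And>a b. a \<in> V \<Longrightarrow> b \<in> V \<Longrightarrow> ip d (f a) (f b) \<noteq> 0 \<or> ip d (g a) (g b) \<noteq> 0
        \<Longrightarrow> ip d (h a) (h b) \<noteq> 0" by metis
    have "orep V h" using h(1) by (simp add: near_gen_pos_def)
    then have "gen_pos V h" by (rule gen_pos_transfer[OF f(1) subset_refl]) (use h(2) in blast)
    moreover have "ip d (g a) (g b) \<noteq> 0" using ax ab by (simp add: g_def)
    then have "ip d (h a) (h b) \<noteq> 0" using h(3) ab by blast
    moreover have "\<forall>(a, b)\<in>F. ip d (h a) (h b) \<noteq> 0" using f(2) h(3) insert.prems by blast
    ultimately show ?case using e by auto
  qed
  from this[of "E \<inter> V \<times> V"] finite_V obtain f where f: "gen_pos V f"
    "\<forall>(a, b)\<in>E \<inter> V \<times> V. ip d (f a) (f b) \<noteq> 0" by auto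
  have "ip d (f a) (f b) \<noteq> 0 \<longleftrightarrow> (a, b) \<in> E" if "a \<in> V" "b \<in> V" "a \<noteq> b" for a b
  proof (cases "(a, b) \<in> E")
    case True
    then have "(a, b) \<in> E \<inter> V \<times> V" using that by simp
    then show ?thesis using f(2) True by fast
  next
    case False
    have "orep V f" using f(1) by (simp add: gen_pos_def)
    then show ?thesis using that False by (simp add: orep_def)
  qed
  then show ?thesis using that by blast
qed

end

section \<open>Zero forcing in partial k-paths\<close>

lemma rtrancl_crossing:
  assumes "(u, v) \<in> R\<^sup>*" "u \<in> X" "v \<notin> X"
  obtains a b where "(a, b) \<in> R" "a \<in> X" "b \<notin> X"
  using assms by (induction rule: rtrancl_induct) auto

lemma k_path_build_verts:
  assumes "k_path_build k H e"
  shows "finite (pverts H) \<and> e \<subseteq> pverts H \<and> card e = k \<and> parcs H \<subseteq> pverts H \<times> pverts H"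
  using assms
proof induction
  case (init T e\<^sub>0 e\<^sub>1)
  then show ?case by (auto simp: complete_digraph_pair_def)
qed auto

lemma card_subset_vimage_le:
  assumes "inj_on f V" "finite E"
  shows "card {a \<in> V. f a \<in> E} \<le> card E"
  by (rule card_inj_on_le[of f]) (use assms in \<open>auto intro: inj_on_subset\<close>)

text \<open>
  If \<open>u\<close> replaces \<open>w\<close> in the active \<open>k\<close>-set, the other at most \<open>k - 1\<close> active vertices would
  separate the old vertices from \<open>u\<close> unless both \<open>u\<close> and \<open>w\<close> lie in \<open>G\<close> and are adjacent there;
  hence \<open>w\<close> forces \<open>u\<close>. The assumption on arcs that leave \<open>H\<close> records that later
  steps attach to \<open>e\<close> only.
\<close>

lemma k_path_build_forcing:
  fixes G :: "'a pair_pre_digraph" and H :: "'b pair_pre_digraph"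
  assumes "k_path_build k H e"
    and k: "k \<ge> 1" and fin: "finite (pverts G)" and inj: "inj_on f (pverts G)"
    and wf: "parcs G \<subseteq> pverts G \<times> pverts G"
    and conn: "\<And>S u v. \<lbrakk>S \<subseteq> pverts G; card S < k; u \<in> pverts G - S; v \<in> pverts G - S\<rbrakk>
      \<Longrightarrow> (u, v) \<in> (parcs G \<inter> (pverts G - S) \<times> (pverts G - S))\<^sup>*"
    and "\<And>a b. \<lbrakk>(a, b) \<in> parcs G; f a \<in> pverts H; f b \<in> pverts H\<rbrakk> \<Longrightarrow> (f a, f b) \<in> parcs H"
    and "\<And>a b. \<lbrakk>(a, b) \<in> parcs G; f a \<in> pverts H; f b \<notin> pverts H\<rbrakk> \<Longrightarrow> f a \<in> e"
    and "k \<le> card {a \<in> pverts G. f a \<in> pverts H}"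
  shows "\<exists>B \<subseteq> pverts G. card B = k \<and> (force_step G)\<^sup>*\<^sup>* B {a \<in> pverts G. f a \<in> pverts H}"
  using assms(1,7-)
proof (induction rule: k_path_build.induct)
  case (init T e\<^sub>0 e\<^sub>1)
  let ?W = "{a \<in> pverts G. f a \<in> pverts T}"
  have T: "finite (pverts T)" "card (pverts T) = k + 1"
    using init.hyps(1) by (auto simp: complete_digraph_pair_def)
  have "card ?W \<le> k + 1" using card_subset_vimage_le[OF inj T(1)] T(2) by simp
  then consider "card ?W = k" | "card ?W = k + 1" using init.prems(3) by linarith
  then show ?case
  proof cases
    case 1
    then show ?thesis by (intro exI[of _ ?W]) auto
  next
    case 2
    have finW: "finite ?W" using fin by simp
    have "card (f ` ?W) = k + 1" using 2 inj by (subst card_image) (auto intro: inj_on_subset)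
    then have fW: "f ` ?W = pverts T" using T by (intro card_subset_eq) auto
    have "e\<^sub>1 \<noteq> pverts T" using init.hyps(5) T(2) by auto
    \<comment> \<open>All neighbours of the vertex \<open>x\<close> over \<open>w\<close> lie in
      \<open>?W\<close>, since arcs leaving \<open>T\<close> start in the active set. So one
      neighbour \<open>b\<close> of \<open>x\<close> may start white, and \<open>x\<close> forces
      it.\<close>
    then obtain w where w: "w \<in> pverts T" "w \<notin> e\<^sub>1" using init.hyps(4) by blast
    then have "w \<in> f ` ?W" using fW by simp
    then obtain x where x: "x \<in> ?W" "f x = w" by blast
    have "\<not> ?W \<subseteq> {x}" using 2 k card_mono[of "{x}" ?W] by auto
    then obtain y where y: "y \<in> ?W" "y \<noteq> x" by blast
    have "(x, y) \<in> (parcs G \<inter> (pverts G - {}) \<times> (pverts G - {}))\<^sup>*"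
      using x y k by (intro conn) auto
    then obtain a b where "(a, b) \<in> parcs G \<inter> (pverts G - {}) \<times> (pverts G - {})" "a \<in> {x}" "b \<notin> {x}"
      by (rule rtrancl_crossing[where X = "{x}"]) (use y in auto)
    then have b: "(x, b) \<in> parcs G" "b \<noteq> x" by auto
    have out: "c \<in> ?W" if "(x, c) \<in> parcs G" for c
      using init.prems(2)[OF that] x w wf that by auto
    have "{c. (x, c) \<in> parcs G \<and> c \<notin> ?W - {b}} = {b}" using b out by auto
    moreover have "x \<in> ?W - {b}" using x b by auto
    ultimately have "force_step G (?W - {b}) (insert b (?W - {b}))" by (intro force_step.intros)
    moreover have "insert b (?W - {b}) = ?W" using out[OF b(1)] by blast
    moreover have "card (?W - {b}) = k" using 2 out[OF b(1)] finW by (subst card_Diff_singleton) auto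
    ultimately show ?thesis by (intro exI[of _ "?W - {b}"]) auto
  qed
next
  case (extend H e u e')
  let ?H' = "\<lparr>pverts = insert u (pverts H), parcs = parcs H \<union> {u} \<times> e \<union> e \<times> {u}\<rparr>"
  let ?W = "{a \<in> pverts G. f a \<in> pverts H}" and ?W' = "{a \<in> pverts G. f a \<in> pverts ?H'}"
  have H: "finite (pverts H)" "e \<subseteq> pverts H" "card e = k"
    using k_path_build_verts[OF extend.hyps(1)] by auto
  have fin_e: "finite e" using H finite_subset by blast
  have ih1: "(f a, f b) \<in> parcs H" if "(a, b) \<in> parcs G" "f a \<in> pverts H" "f b \<in> pverts H" for a b
    using extend.prems(1)[OF that(1)] that H(2) extend.hyps(2) by auto
  \<comment> \<open>An arc to \<open>u\<close> starts in \<open>e\<close> by construction; an arc to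
    a later vertex starts in \<open>e'\<close>, whose old vertices belong to
    \<open>e\<close>.\<close>
  have ih2: "f a \<in> e" if "(a, b) \<in> parcs G" "f a \<in> pverts H" "f b \<notin> pverts H" for a b
  proof (cases "f b = u")
    case True
    then show ?thesis
      using extend.prems(1)[OF that(1)] that extend.hyps(2) k_path_build_verts[OF extend.hyps(1)] by auto
  next
    case False
    then have "f a \<in> e'" using extend.prems(2)[OF that(1)] that by auto
    then show ?thesis using extend.hyps(2,3) that by auto
  qed
  have IH: "\<exists>B\<subseteq>pverts G. card B = k \<and> (force_step G)\<^sup>*\<^sup>* B ?W" if "k \<le> card ?W"
    by (rule extend.IH, rule ih1, assumption+, rule ih2, assumption+, rule that)
  show ?case
  proof (cases "\<exists>v\<in>pverts G. f v = u")
    case False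
    then have "?W' = ?W" by auto
    then show ?thesis using IH extend.prems(3) by simp
  next
    case True
    then obtain v where v: "v \<in> pverts G" "f v = u" by blast
    have W': "?W' = insert v ?W" using v inj by (auto dest: inj_onD)
    have vW: "v \<notin> ?W" using v extend.hyps by auto
    have finW: "finite ?W" using fin by simp
    show ?thesis
    proof (cases "k \<le> card ?W")
      case False
      \<comment> \<open>Here \<open>v\<close> is the \<open>k\<close>-th vertex of \<open>G\<close>
        to appear; the first \<open>k\<close> simply start blue.\<close>
      then have "card ?W' = k" using extend.prems(3) vW finW unfolding W' by simp
      then show ?thesis by (intro exI[of _ ?W']) auto
    next
      case True
      from IH[OF True]
      obtain B where B: "B \<subseteq> pverts G" "card B = k" "(force_step G)\<^sup>*\<^sup>* B ?W"
        by (elim exE conjE)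
      have "\<not> e \<subseteq> e'"
      proof
        assume "e \<subseteq> e'"
        moreover have "finite e'" using extend.hyps(3) fin_e finite_subset by blast
        ultimately have "e = e'" using extend.hyps(4) H(3) by (intro card_subset_eq) auto
        then show False using extend.hyps(5) by simp
      qed
      then obtain w where w: "w \<in> e" "w \<notin> e'" by blast
      \<comment> \<open>Deleting fewer than \<open>k\<close> vertices leaves \<open>v\<close>
        reachable from an old vertex \<open>x\<close>, so some surviving arc leaves
        \<open>?W\<close>.\<close>
      let ?S = "{a \<in> pverts G. f a \<in> e - {w}}"
      have "card ?S \<le> card (e - {w})" using fin_e by (intro card_subset_vimage_le inj) simp
      also have "\<dots> < k" using w H(3) fin_e by (metis card_Diff1_less)
      finally have cardS: "card ?S < k" .
      have "finite ?S" using fin by simp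
      then have "\<not> ?W \<subseteq> ?S" using card_mono[of ?S ?W] True cardS by linarith
      then obtain x where x: "x \<in> ?W" "x \<notin> ?S" by blast
      have "v \<notin> ?S" using vW H(2) by auto
      then have "(x, v) \<in> (parcs G \<inter> (pverts G - ?S) \<times> (pverts G - ?S))\<^sup>*"
        using x v cardS by (intro conn) auto
      then obtain a b where "(a, b) \<in> parcs G \<inter> (pverts G - ?S) \<times> (pverts G - ?S)"
          and ab': "a \<in> ?W" "b \<notin> ?W"
        using x(1) vW by (rule rtrancl_crossing)
      then have ab: "(a, b) \<in> parcs G" "a \<notin> ?S" "a \<in> ?W" "b \<notin> ?W" by blast+
      have aV: "a \<in> pverts G" and bV: "b \<in> pverts G" using wf ab(1) by auto
      \<comment> \<open>Arcs leaving \<open>?W\<close> start over \<open>e\<close>, of which only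
        \<open>w\<close> survives the deletion of \<open>?S\<close>.\<close>
      have "f a \<in> e" using ih2[OF ab(1)] ab(3,4) bV by auto
      then have fa: "f a = w" using ab(2) aV by auto
      \<comment> \<open>\<open>w\<close> is no longer active, so no vertex after \<open>u\<close>
        attaches to it.\<close>
      have only_v: "c = v" if "(a, c) \<in> parcs G" "c \<notin> ?W" for c
      proof -
        have cV: "c \<in> pverts G" using wf that(1) by auto
        have "f c \<in> pverts ?H'"
          using extend.prems(2)[OF that(1)] ab(3) fa w(2) by auto
        then show ?thesis using that cV v inj by (auto dest: inj_onD)
      qed
      have "{c. (a, c) \<in> parcs G \<and> c \<notin> ?W} = {v}" using ab only_v vW by auto
      then have "force_step G ?W (insert v ?W)" using ab(3) by (intro force_step.intros)
      then have "(force_step G)\<^sup>*\<^sup>* B ?W'"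
        unfolding W' by (rule rtranclp.rtrancl_into_rtrancl[OF B(3)])
      then show ?thesis using B by blast
    qed
  qed
qed

section \<open>Nullity\<close>

lemma kernel_dim_mono:
  assumes A: "A \<in> carrier_mat nr n" and C: "C \<in> carrier_mat nr' n"
    and sub: "mat_kernel C \<subseteq> mat_kernel A"
  shows "kernel_dim C \<le> kernel_dim A"
proof -
  interpret KA: kernel nr n A by unfold_locales (rule A)
  interpret KC: kernel nr' n C by unfold_locales (rule C)
  obtain b where b: "finite b" "KC.basis b" using kernel_basis_exists[OF C] by blast
  obtain a where a: "finite a" "KA.basis a" using kernel_basis_exists[OF A] by blast
  have fin: "KA.Ker.fin_dim" using a unfolding KA.Ker.fin_dim_def KA.Ker.basis_def by blast
  have b_sub: "b \<subseteq> mat_kernel C" and "\<not> KC.lin_dep b"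
    using b(2) unfolding KC.Ker.basis_def by auto
  then have "\<not> KA.lin_dep b" using KA.lindep_same[of b] KC.lindep_same[of b] sub by blast
  then have "card b \<le> KA.dim" using KA.Ker.li_le_dim(2)[OF fin] b_sub sub by blast
  moreover have "KC.dim = card b" using KC.Ker.dim_basis[OF b] .
  ultimately show ?thesis by simp
qed

text \<open>Each pivot of the echelon form lies in its own row, so there are at most
  \<open>d\<close> of them.\<close>

lemma kernel_dim_ge:
  assumes C: "C \<in> carrier_mat d n"
  shows "n - d \<le> kernel_dim C"
proof -
  obtain B where B: "gauss_jordan_single C = B" by simp
  from gauss_jordan_single[OF C B] have B': "B \<in> carrier_mat d n" "row_echelon_form B" by auto
  have "length (pivot_positions B) = card {i. i < d \<and> row B i \<noteq> 0\<^sub>v n}"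
    using find_base_vectors(5)[OF B'(2,1)] .
  also have "\<dots> \<le> card {..<d}" by (intro card_mono) auto
  finally show ?thesis using kernel_dim_code[of C] C B by simp
qed

text \<open>More than \<open>card I\<close> basis vectors of the kernel have dependent restrictions
  to \<open>I\<close>. The same coefficients yield a kernel vector vanishing on \<open>I\<close>,
  hence zero, against independence.\<close>

lemma kernel_dim_le_card_coordinates:
  assumes A: "A \<in> carrier_mat nr n" and I: "finite I" "I \<subseteq> {..<n}"
    and zero: "\<And>x. x \<in> mat_kernel A \<Longrightarrow> (\<And>i. i \<in> I \<Longrightarrow> x $ i = 0) \<Longrightarrow> x = 0\<^sub>v n"
  shows "kernel_dim A \<le> card I"
proof (rule ccontr)
  assume "\<not> kernel_dim A \<le> card I"
  interpret K: kernel nr n A by unfold_locales (rule A)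
  obtain b where b: "finite b" "K.basis b" using kernel_basis_exists[OF A] by blast
  have b_sub: "b \<subseteq> mat_kernel A" and indep: "\<not> K.lin_dep b"
    using b(2) unfolding K.Ker.basis_def by auto
  obtain ws where ws: "set ws = b" "distinct ws" using finite_distinct_list[OF b(1)] by blast
  obtain il where il: "set il = I" "distinct il" using finite_distinct_list[OF I(1)] by blast
  have ws_dim: "set ws \<subseteq> carrier_vec n" using ws b_sub mat_kernel_carrier[OF A] by auto
  define m where "m = length ws"
  define M where "M = mat_of_cols n ws"
  define C where "C = mat (length il) m (\<lambda>(r, j). M $$ (il ! r, j))"
  have M: "M \<in> carrier_mat n m" and cols_M: "cols M = ws"
    using ws_dim by (auto simp: M_def m_def)
  have C: "C \<in> carrier_mat (length il) m" by (simp add: C_def)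
  have "m = kernel_dim A"
    using K.Ker.dim_basis[OF b] ws by (simp add: m_def distinct_card[symmetric])
  then have m: "length il < m"
    using \<open>\<not> kernel_dim A \<le> card I\<close> il by (simp add: distinct_card[symmetric])
  have "\<not> mat_kernel C \<subseteq> {0\<^sub>v m}"
  proof
    assume "mat_kernel C \<subseteq> {0\<^sub>v m}"
    \<comment> \<open>The identity matrix, of nullity 0, serves as comparison.\<close>
    moreover have "0\<^sub>v m \<in> mat_kernel (1\<^sub>m m)" by (rule mat_kernelI[of _ m]) auto
    ultimately have "kernel_dim C \<le> kernel_dim (1\<^sub>m m :: 'a mat)"
      by (intro kernel_dim_mono[OF one_carrier_mat C]) auto
    also have "\<dots> = 0" using kernel_one_mat(1)[of m] by (simp add: kernel_dim_def)
    finally show False using kernel_dim_ge[OF C] m by simp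
  qed
  then obtain c where c: "c \<in> mat_kernel C" "c \<noteq> 0\<^sub>v m" by blast
  have c_dim: "c \<in> carrier_vec m" and Cc: "C *\<^sub>v c = 0\<^sub>v (length il)"
    using mat_kernelD[OF C c(1)] by auto
  define x where "x = M *\<^sub>v c"
  have x_dim: "x \<in> carrier_vec n" using M c_dim by (simp add: x_def)
  have AM: "A * M = 0\<^sub>m nr m"
  proof (rule eq_matI)
    fix i j assume ij: "i < dim_row (0\<^sub>m nr m :: 'a mat)" "j < dim_col (0\<^sub>m nr m :: 'a mat)"
    then have "col M j = ws ! j" using M cols_M cols_nth[of j M] by simp
    moreover have "ws ! j \<in> mat_kernel A" using ij ws b_sub by (auto simp: m_def)
    ultimately have "A *\<^sub>v col M j = 0\<^sub>v nr" using mat_kernelD[OF A] by auto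
    then have "(A *\<^sub>v col M j) $ i = 0" using ij by simp
    then show "(A * M) $$ (i, j) = 0\<^sub>m nr m $$ (i, j)" using ij A M by simp
  qed (use A M in auto)
  have "0\<^sub>m nr m *\<^sub>v c = 0\<^sub>v nr" using c_dim by (intro eq_vecI) auto
  then have "A *\<^sub>v x = 0\<^sub>v nr"
    using assoc_mult_mat_vec[OF A M c_dim] by (simp add: x_def AM)
  then have xK: "x \<in> mat_kernel A" using mat_kernelI[OF A x_dim] by blast
  have "x $ i = 0" if "i \<in> I" for i
  proof -
    have "i \<in> set il" using that il(1) by simp
    then obtain r where r: "r < length il" "il ! r = i" unfolding in_set_conv_nth by blast
    have "i < n" using that I by auto
    then have "row C r = row M i" using r M C by (intro eq_vecI) (auto simp: C_def)
    then have "x $ i = (C *\<^sub>v c) $ r" using r M C \<open>i < n\<close> by (simp add: x_def)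
    then show ?thesis using Cc r by simp
  qed
  then have "x = 0\<^sub>v n" using zero[OF xK] by blast
  then have "K.NC.lin_dep (set (cols M))"
    using K.NC.lin_depI[OF M c_dim c(2)] ws cols_M by (simp add: x_def)
  then show False using indep K.lindep_same[OF b_sub] cols_M ws by simp
qed

text \<open>A kernel vector that vanishes on the blue set keeps doing so: when \<open>u\<close>
  forces \<open>v\<close>, the row of \<open>u\<close> has only the term of \<open>v\<close>
  left.\<close>

lemma kernel_dim_le_zero_forcing:
  assumes A: "A \<in> sym_matrices G" and wf: "parcs G \<subseteq> pverts G \<times> pverts G"
    and fin: "finite (pverts G)" and B: "zero_forcing_set G B"
  shows "kernel_dim A \<le> card B"
proof -
  define n where "n = card (pverts G)"
  obtain f where A_dim: "A \<in> carrier_mat n n" and f: "bij_betw f {..<n} (pverts G)"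
    and A_E: "\<And>i j. i < n \<Longrightarrow> j < n \<Longrightarrow> i \<noteq> j \<Longrightarrow> A $$ (i, j) \<noteq> 0 \<longleftrightarrow> (f i, f j) \<in> parcs G"
    using A unfolding sym_matrices_def n_def by blast
  define I where "I = {i. i < n \<and> f i \<in> B}"
  have fV: "f ` {..<n} = pverts G" and f_inj: "inj_on f {..<n}" using f by (simp_all add: bij_betw_def)
  have B_sub: "B \<subseteq> pverts G" and forces: "(force_step G)\<^sup>*\<^sup>* B (pverts G)"
    using B by (simp_all add: zero_forcing_set_def)
  have "f ` I = B"
  proof
    show "f ` I \<subseteq> B" by (auto simp: I_def)
    show "B \<subseteq> f ` I"
    proof
      fix b assume b: "b \<in> B"
      then have "b \<in> f ` {..<n}" using B_sub fV by auto
      then show "b \<in> f ` I" using b by (auto simp: I_def)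
    qed
  qed
  moreover have "inj_on f I" by (rule inj_on_subset[OF f_inj]) (auto simp: I_def)
  ultimately have card_I: "card I = card B" using card_image[of f I] by simp
  have "kernel_dim A \<le> card I"
  proof (rule kernel_dim_le_card_coordinates[OF A_dim])
    fix x assume x: "x \<in> mat_kernel A" and x_I: "\<And>i. i \<in> I \<Longrightarrow> x $ i = 0"
    have x_dim: "x \<in> carrier_vec n" and Ax: "A *\<^sub>v x = 0\<^sub>v n" using mat_kernelD[OF A_dim x] by auto
    have "\<forall>i<n. f i \<in> C \<longrightarrow> x $ i = 0" if "(force_step G)\<^sup>*\<^sup>* B C" for C
      using that
    proof (induction rule: rtranclp_induct)
      case base
      then show ?case using x_I by (simp add: I_def)
    next
      case (step C D)
      from step.hyps(2) show ?case
      proof cases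
        case (1 u v)
        have uv: "(u, v) \<in> parcs G" "v \<notin> C" using 1(3) by auto
        have "u \<in> f ` {..<n}" "v \<in> f ` {..<n}" unfolding fV using uv(1) wf by auto
        then obtain i j where ij: "i < n" "f i = u" "j < n" "f j = v" by auto
        have "i \<noteq> j" using ij 1(2) uv(2) by auto
        then have Aij: "A $$ (i, j) \<noteq> 0" using A_E ij uv(1) by simp
        \<comment> \<open>The term \<open>l = i\<close> with the unrestricted diagonal entry is in
          the first case, since \<open>u\<close> is blue.\<close>
        have others: "A $$ (i, l) * x $ l = 0" if l: "l < n" "l \<noteq> j" for l
        proof (cases "f l \<in> C")
          case True
          then show ?thesis using step.IH l by simp
        next
          case False
          have "f l \<noteq> v" using l ij f_inj by (auto simp: inj_on_def)
          then have "(u, f l) \<notin> parcs G" using False 1(3) by auto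
          moreover have "i \<noteq> l" using False ij 1(2) by auto
          ultimately show ?thesis using A_E[of i l] ij l by auto
        qed
        have "0 = (A *\<^sub>v x) $ i" using Ax ij by simp
        also have "\<dots> = (\<Sum>l<n. A $$ (i, l) * x $ l)"
          using A_dim x_dim ij by (simp add: scalar_prod_def lessThan_atLeast0)
        also have "\<dots> = A $$ (i, j) * x $ j"
        proof -
          have "(\<Sum>l\<in>{..<n} - {j}. A $$ (i, l) * x $ l) = 0"
            using others by (intro sum.neutral) blast
          then show ?thesis using ij(3) by (simp add: sum.remove[of _ j])
        qed
        finally have "x $ j = 0" using Aij by simp
        moreover have "l = j" if "l < n" "f l = v" for l
          using that ij f_inj by (auto simp: inj_on_def)
        ultimately show ?thesis using step.IH 1(1) by auto
      qed
    qed
    from this[OF forces] have "\<forall>i<n. x $ i = 0" using fV by blast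
    then show "x = 0\<^sub>v n" using x_dim by (intro eq_vecI) auto
  qed (auto simp: I_def)
  then show ?thesis by (simp add: card_I)
qed

section \<open>Vertex connectivity as reachability\<close>

lemma connected_induce_subgraphD:
  assumes "pair_graph G" "Digraph_Component.connected (with_proj G \<restriction> W)" "u \<in> W" "v \<in> W"
  shows "(u, v) \<in> (parcs G \<inter> W \<times> W)\<^sup>*"
proof -
  interpret pair_graph G by fact
  let ?M = "mk_symmetric (with_proj G \<restriction> W)"
  have "u \<rightarrow>\<^sup>*\<^bsub>with_proj ?M\<^esub> v"
    using assms(2-4) unfolding Digraph_Component.connected_def strongly_connected_def by simp
  then have "(u, v) \<in> rtrancl_on W (parcs ?M)"
    by (simp add: reachable_def)
  then have "(u, v) \<in> (parcs ?M)\<^sup>*"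
    by (rule rtrancl_on_rtranclI)
  \<comment> \<open>The arcs of \<open>G\<close> are symmetric, so the symmetric closure adds
    none.\<close>
  moreover have "parcs ?M \<subseteq> parcs G \<inter> W \<times> W"
    using arcs_ends_symmetric sym_arcs by (auto simp: parcs_mk_symmetric symmetric_def dest: symD)
  ultimately show ?thesis using rtrancl_mono by blast
qed

lemma k_connectedD:
  fixes G :: "'a pair_pre_digraph"
  assumes k: "k \<ge> 1" and G: "pair_graph G" and conn: "k_connected k G"
  shows "k < card (pverts G)"
    and "\<And>S u v. \<lbrakk>S \<subseteq> pverts G; card S < k; u \<in> pverts G - S; v \<in> pverts G - S\<rbrakk>
      \<Longrightarrow> (u, v) \<in> (parcs G \<inter> (pverts G - S) \<times> (pverts G - S))\<^sup>*"
proof -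
  interpret pair_graph G by fact
  let ?V = "pverts G"
  let ?Cut = "{X. X \<subseteq> ?V \<and> \<not> Digraph_Component.connected (with_proj G \<restriction> (?V - X))}"
  have fin: "finite ?V" by (rule pair_finite_verts)
  have "k < card ?V \<and> (\<forall>S u v. S \<subseteq> ?V \<longrightarrow> card S < k \<longrightarrow> u \<in> ?V - S \<longrightarrow> v \<in> ?V - S
      \<longrightarrow> (u, v) \<in> (parcs G \<inter> (?V - S) \<times> (?V - S))\<^sup>*)"
  proof (cases "K\<^bsub>card ?V\<^esub> (with_proj G)")
    case True
    then have "k \<le> card ?V - 1" using conn by (simp add: k_connected_def vertex_connectivity_def)
    moreover have E: "parcs G = {(u, v). (u, v) \<in> ?V \<times> ?V \<and> u \<noteq> v}"
      using True by (simp add: complete_digraph_pair_def)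
    have "(u, v) \<in> (parcs G \<inter> (?V - S) \<times> (?V - S))\<^sup>*" if "u \<in> ?V - S" "v \<in> ?V - S" for S u v
    proof (cases "u = v")
      case False
      then show ?thesis using that by (intro r_into_rtrancl) (simp add: E)
    qed simp
    ultimately show ?thesis using k by auto
  next
    case False
    have cut: "k \<le> card X" if "X \<in> ?Cut" for X
    proof -
      have "finite (card ` ?Cut)" using fin by simp
      then have "Min (card ` ?Cut) \<le> card X" using that by (intro Min_le) blast+
      then show ?thesis using conn False by (simp add: k_connected_def vertex_connectivity_def)
    qed
    have "parcs G \<noteq> {(u, v). (u, v) \<in> ?V \<times> ?V \<and> u \<noteq> v}"
      using False fin by (simp add: complete_digraph_pair_def)
    moreover have "parcs G \<subseteq> {(u, v). (u, v) \<in> ?V \<times> ?V \<and> u \<noteq> v}"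
    proof (rule subrelI)
      fix a b assume "(a, b) \<in> parcs G"
      then show "(a, b) \<in> {(u, v). (u, v) \<in> ?V \<times> ?V \<and> u \<noteq> v}"
        using in_arcsD1[of a b] in_arcsD2[of a b] no_loops'[of a b] by simp
    qed
    ultimately obtain u v where uv: "u \<in> ?V" "v \<in> ?V" "u \<noteq> v" "(u, v) \<notin> parcs G" by auto
    \<comment> \<open>Removing all vertices except the nonadjacent \<open>u\<close> and
      \<open>v\<close> disconnects, so \<open>k\<close> is at most the number of the removed
      ones.\<close>
    have UV: "?V - (?V - {u, v}) = {u, v}" using uv by auto
    have "\<not> Digraph_Component.connected (with_proj G \<restriction> {u, v})"
    proof
      assume "Digraph_Component.connected (with_proj G \<restriction> {u, v})"
      then have "(u, v) \<in> (parcs G \<inter> {u, v} \<times> {u, v})\<^sup>*"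
        by (rule connected_induce_subgraphD[OF G]) auto
      then show False
      proof (cases rule: converse_rtranclE)
        case (step y)
        then have "(u, y) \<in> parcs G" "y = u \<or> y = v" by auto
        then show False using uv(4) no_loops'[of u y] by auto
      qed (use uv(3) in simp)
    qed
    then have "k \<le> card (?V - {u, v})" using cut[of "?V - {u, v}"] UV by simp
    also have "\<dots> < card ?V" using uv fin by (intro psubset_card_mono) auto
    finally have "k < card ?V" .
    moreover have "(x, y) \<in> (parcs G \<inter> (?V - S) \<times> (?V - S))\<^sup>*"
      if "S \<subseteq> ?V" "card S < k" "x \<in> ?V - S" "y \<in> ?V - S" for S x y
    proof (rule connected_induce_subgraphD[OF G _ that(3,4)])
      show "Digraph_Component.connected (with_proj G \<restriction> (?V - S))"
      proof (rule ccontr)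
        assume "\<not> ?thesis"
        then have "k \<le> card S" using that(1) by (intro cut) simp
        then show False using that(2) by simp
      qed
    qed
    ultimately show ?thesis by blast
  qed
  then show "k < card ?V" "\<And>S u v. \<lbrakk>S \<subseteq> ?V; card S < k; u \<in> ?V - S; v \<in> ?V - S\<rbrakk>
      \<Longrightarrow> (u, v) \<in> (parcs G \<inter> (?V - S) \<times> (?V - S))\<^sup>*"
    by blast+
qed

section \<open>Gram matrices and the final equality\<close>

lemma sym_matrix_large_nullity:
  fixes G :: "'a pair_pre_digraph"
  assumes k: "k \<ge> 1" and G: "pair_graph G" and conn: "k_connected k G"
  shows "\<exists>A\<in>sym_matrices G. k \<le> kernel_dim A"
proof -
  interpret pair_graph G by fact
  define n where "n = card (pverts G)"
  have kn: "k < n" using k_connectedD(1)[OF assms] by (simp add: n_def)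
  have fin: "finite (pverts G)" by (rule pair_finite_verts)
  interpret connected_orth_rep "n - k" "parcs G" "pverts G"
  proof
    show "sym (parcs G)" using sym_arcs by (simp add: symmetric_def)
    show "(v, v) \<notin> parcs G" for v using no_loops' by blast
    show "0 < n - k" using kn by simp
    fix J u v assume J: "J \<subseteq> pverts G" "n - k < card J" and uv: "u \<in> J" "v \<in> J"
    have J_eq: "pverts G - (pverts G - J) = J" using J(1) by blast
    have "card (pverts G - J) = n - card J"
      unfolding n_def by (rule card_Diff_subset[OF finite_subset[OF J(1) fin] J(1)])
    moreover have "card J \<le> n" using J(1) fin by (simp add: n_def card_mono)
    ultimately have "card (pverts G - J) < k" using J(2) kn by linarith
    then show "(u, v) \<in> (parcs G \<inter> J \<times> J)\<^sup>*"
      using k_connectedD(2)[OF assms, of "pverts G - J" u v] J_eq uv by simp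
  qed (rule fin)
  obtain f where f: "\<And>a b. a \<in> pverts G \<Longrightarrow> b \<in> pverts G \<Longrightarrow> a \<noteq> b
      \<Longrightarrow> ip (n - k) (f a) (f b) \<noteq> 0 \<longleftrightarrow> (a, b) \<in> parcs G"
    using faithful_orth_rep by blast
  obtain \<beta> where \<beta>: "bij_betw \<beta> {..<n} (pverts G)"
    using ex_bij_betw_nat_finite[OF fin] by (auto simp: n_def lessThan_atLeast0)
  define F where "F = mat (n - k) n (\<lambda>(l, i). f (\<beta> i) l)"
  \<comment> \<open>The Gram matrix of the representation; its kernel contains that of
    \<open>F\<close>, which has only \<open>n - k\<close> rows.\<close>
  define A where "A = F\<^sup>T * F"
  have F: "F \<in> carrier_mat (n - k) n" by (simp add: F_def)
  have A: "A \<in> carrier_mat n n" using F by (simp add: A_def)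
  have A_ij: "A $$ (i, j) = ip (n - k) (f (\<beta> i)) (f (\<beta> j))" if "i < n" "j < n" for i j
    using that by (simp add: A_def F_def scalar_prod_def ip_def lessThan_atLeast0)
  have "A\<^sup>T = A" using transpose_mult[of "F\<^sup>T" n "n - k" F n] F by (simp add: A_def)
  moreover have "A $$ (i, j) \<noteq> 0 \<longleftrightarrow> (\<beta> i, \<beta> j) \<in> parcs G" if "i < n" "j < n" "i \<noteq> j" for i j
    using that f[of "\<beta> i" "\<beta> j"] \<beta> by (auto simp: A_ij bij_betw_def inj_on_def)
  ultimately have "A \<in> sym_matrices G"
    using A \<beta> unfolding sym_matrices_def n_def[symmetric] by blast
  moreover have "mat_kernel F \<subseteq> mat_kernel A"
    unfolding A_def by (rule mat_kernel_mult_subset[OF F]) (use F in simp)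
  then have "kernel_dim F \<le> kernel_dim A" by (rule kernel_dim_mono[OF A F])
  then have "k \<le> kernel_dim A" using kernel_dim_ge[OF F] kn by linarith
  ultimately show ?thesis by blast
qed

theorem mainTheorem5:
  fixes G :: "'a pair_pre_digraph" and k :: nat
  assumes "k \<ge> 1"
    and "pair_graph G"
    and "k_connected k G"
    and "partial_k_path k G"
  shows "zero_forcing_number G = k \<and> max_nullity G = k"
proof -
  interpret pair_graph G by fact
  have fin: "finite (pverts G)" by (rule pair_finite_verts)
  have wf: "parcs G \<subseteq> pverts G \<times> pverts G" using in_arcsD1 in_arcsD2 by auto
  note conn = k_connectedD[OF assms(1-3)]
  obtain H :: "nat pair_pre_digraph" and f e where H: "k_path_build k H e" and f: "inj_on f (pverts G)"
    and sub: "f ` pverts G \<subseteq> pverts H" "map_prod f f ` parcs G \<subseteq> parcs H"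
    using assms(4) unfolding partial_k_path_def k_path_def subgraph_def by auto
  have all: "{a \<in> pverts G. f a \<in> pverts H} = pverts G" using sub(1) by auto
  have "\<exists>B \<subseteq> pverts G. card B = k \<and> (force_step G)\<^sup>*\<^sup>* B {a \<in> pverts G. f a \<in> pverts H}"
  proof (rule k_path_build_forcing[OF H assms(1) fin f wf conn(2)])
    show "(f a, f b) \<in> parcs H" if "(a, b) \<in> parcs G" for a b
      using sub(2) that by force
    \<comment> \<open>All of \<open>G\<close> maps into \<open>H\<close>, so no arc leaves
      \<open>H\<close>.\<close>
    show "f a \<in> e" if "(a, b) \<in> parcs G" "f b \<notin> pverts H" for a b
      using that sub(1) wf by auto
    show "k \<le> card {a \<in> pverts G. f a \<in> pverts H}" using conn(1) by (simp add: all)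
  qed
  then obtain B where B: "zero_forcing_set G B" "card B = k"
    unfolding all zero_forcing_set_def by blast
  obtain A where A: "A \<in> sym_matrices G" "k \<le> kernel_dim A"
    using sym_matrix_large_nullity[OF assms(1-3)] by blast
  note bound = kernel_dim_le_zero_forcing[OF _ wf fin]
  have "zero_forcing_number G = k"
    unfolding zero_forcing_number_def
  proof (rule Min_eqI)
    have "{B. zero_forcing_set G B} \<subseteq> Pow (pverts G)" by (auto simp: zero_forcing_set_def)
    then have "finite {B. zero_forcing_set G B}" by (rule finite_subset) (simp add: fin)
    then show "finite (card ` {B. zero_forcing_set G B})" by (rule finite_imageI)
    show "k \<in> card ` {B. zero_forcing_set G B}" using B by blast
    show "k \<le> m" if m: "m \<in> card ` {B. zero_forcing_set G B}" for m
    proof -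
      obtain B' where B': "zero_forcing_set G B'" "m = card B'" using m by blast
      show ?thesis using bound[OF A(1) B'(1)] A(2) B'(2) by simp
    qed
  qed
  moreover have "max_nullity G = k"
    unfolding max_nullity_def
  proof (rule Max_eqI)
    have le: "m \<le> k" if m: "m \<in> kernel_dim ` sym_matrices G" for m
    proof -
      obtain A' where A': "A' \<in> sym_matrices G" "m = kernel_dim A'" using m by blast
      show ?thesis using bound[OF A'(1) B(1)] A'(2) B(2) by simp
    qed
    \<comment> \<open>The uniform bound makes the set of nullities finite, as \<open>Max\<close>
      requires.\<close>
    then show "finite (kernel_dim ` sym_matrices G)" by (meson finite_nat_set_iff_bounded_le)
    show "m \<le> k" if "m \<in> kernel_dim ` sym_matrices G" for m using le that .
    have "kernel_dim A = k" using le[of "kernel_dim A"] A by (simp add: le_antisym)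
    then show "k \<in> kernel_dim ` sym_matrices G" using A(1) by blast
  qed
  ultimately show ?thesis by blast
qed

end
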